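(* Let $E,F$ be Banach spaces, $U\subset E$ an open set containing the point $x_0$, and $f:U\to F$ a $c^1$ map. If $x_0$ is a generalized regular point of $f$, then the family $\mathcal F=\{N(f'(x)):x\in U\}$ is $c^1$ integrable at $x_0$, and the corresponding co-tailed set $J(x_0,E_* )$, where $E_*=R(f'(x_0)^{+})$ for any generalized inverse $f'(x_0)^{+}$ of $f'(x_0)$, is trivial.
   Context: $R(\cdot)$ and $N(\cdot)$ denote range and null space; $f'$ is the Fréchet derivative; $B(E,F)$ is the space of bounded linear operators. A generalized inverse of $A\in B(E,F)$ is an operator $A^{+}\in B(F,E)$ with $A^{+}AA^{+}=A^{+}$ and $AA^{+}A=A$; then $E=N(A)\oplus R(A^{+})$ and $F=R(A)\oplus N(A^{+})$. $M\oplus N=E$ means that $M,N$ are closed subspaces with $M\cap N=\{0\}$ and $M+N=E$; $M$ is then said to be splitting in $E$. Generalized regular point: $x_0$ is a generalized regular point of $f$ if it is a locally fine point of $x\mapsto f'(x)$, i.e. $f'(x_0)$ has a generalized inverse $f'(x_0)^{+}$ and there is a neighborhood $U_0\subset U$ of $x_0$ with $R(f'(x))\cap N(f'(x_0)^{+})=\{0\}$ for all $x\in U_0$. (This property does not depend on the choice of $f'(x_0)^{+}$.) Co-tailed set of a family $\mathcal F=\{M(x):x\in U\}$ of subspaces of $E$: if $E=M(x_0)\oplus E_*$, then $J(x_0,E_* )=\{x\in U:M(x)\oplus E_*=E\}$; it is called trivial if $x_0$ is an inner point of $J(x_0,E_* )$. A subset $S\subset E$ is a $c^1$ submanifold of $E$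 if for each $x\in S$ there are a subspace $E_0$ splitting in $E$, a neighborhood $W$ of $x$ in $E$, and a $c^1$ diffeomorphism $\varphi$ of $W$ onto an open set $\varphi(W)\subset E$ such that $\varphi(S\cap W)$ is an open set in $E_0$. The tangent space is $T_xS=\{\dot c(0): c:(-\delta,\delta)\to S \text{ a } c^1 \text{ curve with } c(0)=x,\ \delta>0\}$. $\mathcal F$ is $c^1$ integrable at $x_0$ if there is a $c^1$ submanifold $S$ of $E$ with $x_0\in S\subset U$ and $T_xS=M(x)$ for all $x\in S$. *)

theory Defs
  imports "HOL-Analysis.Analysis"
begin

section \<open>Topological direct sums and generalized inverses\<close>

definition direct_sum_decomp :: "'a::real_normed_vector set \<Rightarrow> 'a set \<Rightarrow> bool" where
  "direct_sum_decomp M N \<longleftrightarrow>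
     subspace M \<and> closed M \<and> subspace N \<and> closed N \<and> M \<inter> N = {0} \<and> M + N = UNIV"

definition splitting :: "'a::real_normed_vector set \<Rightarrow> bool" where
  "splitting M \<longleftrightarrow> (\<exists>N. direct_sum_decomp M N)"

definition null_space :: "('a::real_normed_vector \<Rightarrow>\<^sub>L 'b::real_normed_vector) \<Rightarrow> 'a set" where
  "null_space A = {x. blinfun_apply A x = 0}"

definition generalized_inverse ::
  "('a::real_normed_vector \<Rightarrow>\<^sub>L 'b::real_normed_vector) \<Rightarrow> ('b \<Rightarrow>\<^sub>L 'a) \<Rightarrow> bool" where
  "generalized_inverse A B \<longleftrightarrow> B o\<^sub>L A o\<^sub>L B = B \<and> A o\<^sub>L B o\<^sub>L A = A"

section \<open>Continuously differentiable maps on open sets\<close>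

text \<open>
  A map defined on an open subset is represented by a total function; only its values on that
  set matter. The term \<open>fderiv f x\<close> is meaningful only where \<open>f\<close> is differentiable.
\<close>

definition fderiv ::
  "('a::real_normed_vector \<Rightarrow> 'b::real_normed_vector) \<Rightarrow> 'a \<Rightarrow> ('a \<Rightarrow>\<^sub>L 'b)" where
  "fderiv f x = Blinfun (frechet_derivative f (at x))"

definition C1_map_on ::
  "'a::real_normed_vector set \<Rightarrow> ('a \<Rightarrow> 'b::real_normed_vector) \<Rightarrow> bool" where
  "C1_map_on U f \<longleftrightarrow>
     open U \<and> (\<forall>x\<in>U. f differentiable (at x)) \<and> continuous_on U (fderiv f)"

definition C1_diffeomorphism_on ::
  "'a::real_normed_vector set \<Rightarrow> ('a \<Rightarrow> 'b::real_normed_vector) \<Rightarrow> bool" where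
  "C1_diffeomorphism_on W \<phi> \<longleftrightarrow>
     C1_map_on W \<phi> \<and> (\<exists>\<psi>. homeomorphism W (\<phi> ` W) \<phi> \<psi> \<and> C1_map_on (\<phi> ` W) \<psi>)"

section \<open>Generalized regular points\<close>

definition locally_fine_point ::
  "'c::topological_space set \<Rightarrow>
   ('c \<Rightarrow> ('a::real_normed_vector \<Rightarrow>\<^sub>L 'b::real_normed_vector)) \<Rightarrow> 'c \<Rightarrow> bool" where
  "locally_fine_point U T x0 \<longleftrightarrow>
     (\<exists>B. generalized_inverse (T x0) B \<and>
        (\<exists>U0. open U0 \<and> x0 \<in> U0 \<and> U0 \<subseteq> U \<and>
           (\<forall>x\<in>U0. range (blinfun_apply (T x)) \<inter> null_space B = {0})))"

definition generalized_regular_point ::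
  "'a::real_normed_vector set \<Rightarrow> ('a \<Rightarrow> 'b::real_normed_vector) \<Rightarrow> 'a \<Rightarrow> bool" where
  "generalized_regular_point U f x0 \<longleftrightarrow> locally_fine_point U (fderiv f) x0"

section \<open>Co-tailed sets and integrability of families of subspaces\<close>

text \<open>
  A family of subspaces over \<open>U\<close> is a function \<open>M\<close> of which only the values on \<open>U\<close> matter.
\<close>

definition cotailed_set ::
  "'a::real_normed_vector set \<Rightarrow> ('a \<Rightarrow> 'a set) \<Rightarrow> 'a set \<Rightarrow> 'a set" where
  "cotailed_set U M Es = {x \<in> U. direct_sum_decomp (M x) Es}"

definition trivial_cotailed_set ::
  "'a::real_normed_vector set \<Rightarrow> ('a \<Rightarrow> 'a set) \<Rightarrow> 'a \<Rightarrow> 'a set \<Rightarrow> bool" where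
  "trivial_cotailed_set U M x0 Es \<longleftrightarrow>
     direct_sum_decomp (M x0) Es \<and> x0 \<in> interior (cotailed_set U M Es)"

definition C1_submanifold :: "'a::real_normed_vector set \<Rightarrow> bool" where
  "C1_submanifold S \<longleftrightarrow>
     (\<forall>x\<in>S. \<exists>E0 W \<phi>. splitting E0 \<and> open W \<and> x \<in> W \<and>
        C1_diffeomorphism_on W (\<phi> :: 'a \<Rightarrow> 'a) \<and>
        openin (top_of_set E0) (\<phi> ` (S \<inter> W)))"

definition tangent_space :: "'a::real_normed_vector set \<Rightarrow> 'a \<Rightarrow> 'a set" where
  "tangent_space S x =
     {v. \<exists>\<delta>>0. \<exists>c. c C1_differentiable_on {-\<delta><..<\<delta>} \<and> c ` {-\<delta><..<\<delta>} \<subseteq> S \<and> c 0 = x \<and>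
        (c has_vector_derivative v) (at 0)}"

definition C1_integrable_at ::
  "'a::real_normed_vector set \<Rightarrow> ('a \<Rightarrow> 'a set) \<Rightarrow> 'a \<Rightarrow> bool" where
  "C1_integrable_at U M x0 \<longleftrightarrow>
     (\<exists>S. C1_submanifold S \<and> x0 \<in> S \<and> S \<subseteq> U \<and> (\<forall>x\<in>S. tangent_space S x = M x))"

end

theory Submission
  imports Defs
begin

text \<open>
  Write \<open>A = f'(x0)\<close> and let \<open>B\<close> be a generalized inverse of \<open>A\<close> that witnesses the local fineness
  of \<open>f'\<close> at \<open>x0\<close>. The range of \<open>f'(x)\<close> meets the kernel of \<open>B\<close> only in \<open>0\<close>, so for \<open>x\<close> near \<open>x0\<close>
  the kernel of \<open>f'(x)\<close> does not change when \<open>f'(x)\<close> is replaced by \<open>B f'(x)\<close>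
  (\<open>null_space_compose_of_disjoint\<close>). Thus only the part \<open>B f\<close> of \<open>f\<close> matters, and this part behaves
  like a submersion onto the range of \<open>B\<close>.

  The map \<open>\<phi> x = (x - x0) + B (f x - f x0 - A (x - x0))\<close> makes this precise. Its derivative
  \<open>I + B (f'(x) - A)\<close> is close to the identity, so that \<open>\<phi>\<close> is a \<open>C1\<close> diffeomorphism of a ball around
  \<open>x0\<close> (\<open>near_identity_diffeomorphism\<close>, an inverse function theorem). The identity \<open>B A B = B\<close> gives
  \<open>B A (\<phi> x) = B (f x - f x0)\<close>. Therefore \<open>\<phi>\<close> carries the level set \<open>S\<close> of \<open>B f\<close> through \<open>x0\<close> onto an
  open piece of the kernel of \<open>A\<close>, and \<open>S\<close> is a submanifold. Differentiating \<open>B f\<close> along curves in \<open>S\<close>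
  shows that tangent vectors lie in the kernel of \<open>B f'(x)\<close>, that is, of \<open>f'(x)\<close>; conversely, a vector
  of this kernel is the velocity of the \<open>\<phi>\<close>-preimage of a line in the kernel of \<open>A\<close>.

  For the co-tailed set, let \<open>B'\<close> be an arbitrary generalized inverse of \<open>A\<close>. The operator
  \<open>I + B' A B (f'(x) - A)\<close> equals \<open>(I - B' A) + B' A B f'(x)\<close>; once it is close enough to the identity
  to be bijective, reading it on its two summands gives the decomposition of the space into the kernel
  of \<open>f'(x)\<close> and the range of \<open>B'\<close> (\<open>direct_sum_null_space_range\<close>).
\<close>

section \<open>Perturbations of the identity\<close>

text \<open>
  The equation \<open>x + g x = y\<close> says that \<open>x\<close> is a fixed point of \<open>\<lambda>x. y - g x\<close>, which contracts by
  \<open>1/2\<close> and maps the ball into itself because it moves the centre by at most \<open>r/2\<close>.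
\<close>

lemma perturbed_identity_solve:
  fixes g :: "'a::banach \<Rightarrow> 'a"
  assumes lip: "\<And>x y. x \<in> cball a r \<Longrightarrow> y \<in> cball a r \<Longrightarrow> norm (g x - g y) \<le> norm (x - y) / 2"
    and close: "norm (y - (a + g a)) \<le> r / 2"
  shows "\<exists>x\<in>cball a r. x + g x = y"
proof -
  have r: "r \<ge> 0" using close norm_ge_zero[of "y - (a + g a)"] by linarith
  have "\<exists>!x\<in>cball a r. y - g x = x"
  proof (rule Banach_fix[where c = "1/2"])
    show "complete (cball a r)" by (simp add: complete_eq_closed)
    show "cball a r \<noteq> {}" using r by simp
    show "(\<lambda>x. y - g x) ` cball a r \<subseteq> cball a r"
    proof clarify
      fix x assume x: "x \<in> cball a r"
      have "norm (y - g x - a) = norm ((y - (a + g a)) + (g a - g x))" by (simp add: algebra_simps)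
      also have "\<dots> \<le> norm (y - (a + g a)) + norm (g a - g x)" by (rule norm_triangle_ineq)
      also have "norm (g a - g x) \<le> norm (a - x) / 2" using lip x r by simp
      also have "norm (a - x) \<le> r" using x by (simp add: dist_norm)
      finally have "norm (y - g x - a) \<le> r" using close by simp
      then show "y - g x \<in> cball a r" by (simp add: dist_norm norm_minus_commute)
    qed
    show "\<And>x z. x \<in> cball a r \<Longrightarrow> z \<in> cball a r \<Longrightarrow> dist (y - g x) (y - g z) \<le> 1 / 2 * dist x z"
      using lip by (simp add: dist_norm norm_minus_commute)
  qed auto
  then obtain x where "x \<in> cball a r" "y - g x = x" by blast
  then show ?thesis by (metis diff_add_cancel)
qed

lemma perturbed_identity_expansive:
  fixes u v :: "'a::real_normed_vector"
  assumes "norm (g u - g v) \<le> norm (u - v) / 2"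
  shows "norm (u - v) \<le> 2 * norm ((u + g u) - (v + g v))"
proof -
  have "norm (u - v) = norm (((u + g u) - (v + g v)) - (g u - g v))" by (simp add: algebra_simps)
  also have "\<dots> \<le> norm ((u + g u) - (v + g v)) + norm (g u - g v)" by (rule norm_triangle_ineq4)
  finally show ?thesis using assms by linarith
qed

text \<open>
  Since \<open>C - I\<close> is linear, it has the Lipschitz constant \<open>1/2\<close> on every ball, so \<open>C x = y\<close> can be
  solved for arbitrary \<open>y\<close>: the ball of radius \<open>2 * norm y\<close> around \<open>0\<close> is large enough. The expansion
  estimate yields uniqueness and the bound for the inverse.
\<close>

lemma near_identity_inverse:
  fixes C :: "'a::banach \<Rightarrow>\<^sub>L 'a"
  assumes near: "norm (C - id_blinfun) \<le> 1/2"
  obtains D :: "'a \<Rightarrow>\<^sub>L 'a" where "\<And>x. D (C x) = x" "\<And>y. C (D y) = y" "norm D \<le> 2"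
proof -
  let ?g = "\<lambda>x. (C - id_blinfun) x"
  have Cg: "C x = x + ?g x" for x by (simp add: blinfun.diff_left)
  have lip: "norm (?g x - ?g y) \<le> norm (x - y) / 2" for x y
  proof -
    have "norm (?g x - ?g y) = norm (?g (x - y))" by (simp only: blinfun.diff_right)
    also have "\<dots> \<le> norm (C - id_blinfun) * norm (x - y)" by (rule norm_blinfun)
    also have "\<dots> \<le> 1/2 * norm (x - y)" by (rule mult_right_mono[OF near]) simp
    finally show ?thesis by simp
  qed
  have expand: "norm (x - y) \<le> 2 * norm (C x - C y)" for x y
    unfolding Cg by (rule perturbed_identity_expansive[OF lip])
  have "inj C"
  proof (rule injI)
    fix x y assume "C x = C y"
    then show "x = y" using expand[of x y] by simp
  qed
  have "\<exists>x. C x = y" for y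
    using perturbed_identity_solve[of 0 "2 * norm y" ?g y] lip unfolding Cg by auto
  then have surj: "surj C" by (metis surjI)
  define d where "d = inv C"
  have Cd: "C (d y) = y" for y unfolding d_def by (rule surj_f_inv_f[OF surj])
  have dC: "d (C x) = x" for x unfolding d_def by (rule inv_f_f[OF \<open>inj C\<close>])
  have dn: "norm (d y) \<le> 2 * norm y" for y using expand[of "d y" 0] by (simp add: Cd)
  have "bounded_linear d"
  proof (rule bounded_linear_intro[where K = 2])
    show "d (x + y) = d x + d y" for x y by (metis Cd dC blinfun.add_right)
    show "d (r *\<^sub>R x) = r *\<^sub>R d x" for r x by (metis Cd dC blinfun.scaleR_right)
    show "norm (d x) \<le> norm x * 2" for x using dn[of x] by simp
  qed
  then have ap: "blinfun_apply (Blinfun d) = d" by (rule bounded_linear_Blinfun_apply)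
  show ?thesis
  proof
    show "norm (Blinfun d) \<le> 2" by (rule norm_blinfun_bound) (simp_all add: ap dn)
  qed (simp_all add: ap Cd dC)
qed

section \<open>An inverse function theorem near the identity\<close>

lemma fderiv_eq:
  assumes "(f has_derivative blinfun_apply D) (at x)"
  shows "fderiv f x = D"
  unfolding fderiv_def using frechet_derivative_at[OF assms] by (metis blinfun_apply_inverse)

lemma C1_map_on_has_derivative:
  assumes "C1_map_on U f" "x \<in> U"
  shows "(f has_derivative blinfun_apply (fderiv f x)) (at x)"
proof -
  have "(f has_derivative frechet_derivative f (at x)) (at x)"
    using assms by (auto simp: C1_map_on_def frechet_derivative_works)
  then show ?thesis
    unfolding fderiv_def by (simp add: bounded_linear_Blinfun_apply has_derivative_bounded_linear)
qed

lemma C1_map_onI: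
  assumes "open U" "\<And>x. x \<in> U \<Longrightarrow> (f has_derivative blinfun_apply (D x)) (at x)"
    "continuous_on U D"
  shows "C1_map_on U f"
proof -
  have "continuous_on U (fderiv f)"
    by (rule continuous_on_eq[OF assms(3)]) (simp add: fderiv_eq[OF assms(2)])
  then show ?thesis using assms(1,2) unfolding C1_map_on_def differentiable_def by blast
qed

text \<open>
  On a ball the mean value inequality makes \<open>\<phi> - id\<close> Lipschitz with constant \<open>1/2\<close>. Hence \<open>\<phi>\<close> is
  injective with Lipschitz inverse, and its image is open because \<open>\<phi> x = y\<close> can be solved for \<open>y\<close>
  close to any value of \<open>\<phi>\<close>. The derivative of the inverse is continuous by the resolvent identity
  \<open>X - Y = X (Y\<inverse> - X\<inverse>) Y\<close>, as the inverses of \<open>C x\<close> are bounded by \<open>2\<close>.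
\<close>

lemma near_identity_diffeomorphism:
  fixes \<phi> :: "'a::banach \<Rightarrow> 'a" and C :: "'a \<Rightarrow> 'a \<Rightarrow>\<^sub>L 'a"
  assumes deriv: "\<And>x. x \<in> ball x0 r \<Longrightarrow> (\<phi> has_derivative blinfun_apply (C x)) (at x)"
    and cont: "continuous_on (ball x0 r) C"
    and near: "\<And>x. x \<in> ball x0 r \<Longrightarrow> norm (C x - id_blinfun) \<le> 1/2"
  obtains \<psi> where "homeomorphism (ball x0 r) (\<phi> ` ball x0 r) \<phi> \<psi>"
    "C1_map_on (ball x0 r) \<phi>" "C1_map_on (\<phi> ` ball x0 r) \<psi>"
    "\<And>x v. x \<in> ball x0 r \<Longrightarrow> fderiv \<psi> (\<phi> x) (C x v) = v"
proof -
  let ?W = "ball x0 r"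
  let ?V = "\<phi> ` ?W"
  define g where "g x = \<phi> x - x" for x
  have \<phi>g: "\<phi> x = x + g x" for x by (simp add: g_def)
  have lip: "norm (g x - g y) \<le> norm (x - y) / 2" if "x \<in> ?W" "y \<in> ?W" for x y
  proof -
    have "norm (g x - g y) \<le> 1/2 * norm (x - y)"
    proof (rule differentiable_bound[OF convex_ball _ _ that])
      fix z assume z: "z \<in> ?W"
      have "(g has_derivative (\<lambda>h. C z h - h)) (at z)"
        unfolding g_def by (rule has_derivative_diff[OF deriv[OF z] has_derivative_ident])
      moreover have "blinfun_apply (C z - id_blinfun) = (\<lambda>h. C z h - h)"
        by (auto simp: blinfun.diff_left)
      ultimately show "(g has_derivative blinfun_apply (C z - id_blinfun)) (at z within ?W)"
        using has_derivative_at_withinI by metis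
      show "onorm (blinfun_apply (C z - id_blinfun)) \<le> 1/2"
        using near[OF z] by (simp add: norm_blinfun.rep_eq)
    qed
    then show ?thesis by simp
  qed
  have expand: "norm (x - y) \<le> 2 * norm (\<phi> x - \<phi> y)" if "x \<in> ?W" "y \<in> ?W" for x y
    unfolding \<phi>g by (rule perturbed_identity_expansive[OF lip[OF that]])
  have inj: "inj_on \<phi> ?W"
  proof (rule inj_onI)
    fix x y assume "x \<in> ?W" "y \<in> ?W" "\<phi> x = \<phi> y"
    then show "x = y" using expand[of x y] by simp
  qed
  have opn: "open ?V"
    unfolding open_contains_ball
  proof (rule ballI)
    fix y assume "y \<in> ?V"
    then obtain a where a: "a \<in> ?W" "y = \<phi> a" by blast
    obtain s where s: "s > 0" "cball a s \<subseteq> ?W" using open_contains_cball[of ?W] a(1) open_ball by blast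
    have "ball y (s/2) \<subseteq> ?V"
    proof
      fix z assume "z \<in> ball y (s/2)"
      then have "norm (z - (a + g a)) \<le> s / 2" using a(2) by (simp add: dist_norm norm_minus_commute \<phi>g)
      then obtain x where "x \<in> cball a s" "x + g x = z"
        using perturbed_identity_solve[of a s g z] lip s(2) by blast
      then show "z \<in> ?V" using s(2) by (force simp: \<phi>g)
    qed
    then show "\<exists>e>0. ball y e \<subseteq> ?V" using s(1) by (intro exI[of _ "s/2"]) simp
  qed
  define \<psi> where "\<psi> = inv_into ?W \<phi>"
  have \<psi>\<phi>: "\<psi> (\<phi> x) = x" if "x \<in> ?W" for x unfolding \<psi>_def by (rule inv_into_f_f[OF inj that])
  have \<psi>W: "\<psi> y \<in> ?W" if "y \<in> ?V" for y unfolding \<psi>_def by (rule inv_into_into[OF that])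
  have \<phi>\<psi>: "\<phi> (\<psi> y) = y" if "y \<in> ?V" for y unfolding \<psi>_def by (rule f_inv_into_f[OF that])
  have "continuous_on ?V \<psi>"
  proof (rule lipschitz_on_continuous_on[where L = 2], rule lipschitz_onI)
    fix y z assume "y \<in> ?V" "z \<in> ?V"
    then show "dist (\<psi> y) (\<psi> z) \<le> 2 * dist y z"
      using expand[OF \<psi>W \<psi>W, of y z] by (simp add: \<phi>\<psi> dist_norm)
  qed simp
  have \<phi>C1: "C1_map_on ?W \<phi>" by (rule C1_map_onI[OF open_ball deriv cont])
  have cont\<phi>: "continuous_on ?W \<phi>"
    using deriv has_derivative_continuous continuous_at_imp_continuous_on by blast
  have "\<exists>D. (\<forall>v. blinfun_apply D (C x v) = v) \<and> (\<forall>w. C x (blinfun_apply D w) = w) \<and> norm D \<le> 2"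
    if "x \<in> ?W" for x
    by (rule near_identity_inverse[OF near[OF that]]) blast
  then obtain Ci where Ci: "\<And>x v. x \<in> ?W \<Longrightarrow> blinfun_apply (Ci x) (C x v) = v"
    "\<And>x w. x \<in> ?W \<Longrightarrow> C x (blinfun_apply (Ci x) w) = w" "\<And>x. x \<in> ?W \<Longrightarrow> norm (Ci x) \<le> 2"
    by metis
  have contCi: "continuous_on ?W Ci"
    unfolding continuous_on
  proof (rule ballI)
    fix x assume x: "x \<in> ?W"
    have est: "norm (Ci y - Ci x) \<le> 4 * norm (C y - C x)" if y: "y \<in> ?W" for y
    proof -
      have "Ci y - Ci x = Ci y o\<^sub>L (C x - C y) o\<^sub>L Ci x"
        by (rule blinfun_eqI) (simp add: blinfun.diff_left blinfun.diff_right Ci(2)[OF x] Ci(1)[OF y])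
      also have "norm \<dots> \<le> norm (Ci y o\<^sub>L (C x - C y)) * norm (Ci x)" by (rule norm_blinfun_compose)
      also have "\<dots> \<le> (norm (Ci y) * norm (C x - C y)) * norm (Ci x)"
        by (rule mult_right_mono[OF norm_blinfun_compose]) simp
      also have "\<dots> \<le> (2 * norm (C x - C y)) * 2"
        by (intro mult_mono mult_right_mono Ci x y) simp_all
      finally show ?thesis by (simp add: norm_minus_commute)
    qed
    have "((\<lambda>y. 4 * norm (C y - C x)) \<longlongrightarrow> 4 * 0) (at x within ?W)"
      using cont x by (intro tendsto_mult_left tendsto_norm_zero LIM_zero) (simp add: continuous_on)
    then have lim: "((\<lambda>y. 4 * norm (C y - C x)) \<longlongrightarrow> 0) (at x within ?W)" by simp
    have "\<forall>\<^sub>F y in at x within ?W. norm (Ci y - Ci x) \<le> 4 * norm (C y - C x)"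
      unfolding eventually_at_filter using est by (intro always_eventually allI impI)
    then have "((\<lambda>y. Ci y - Ci x) \<longlongrightarrow> 0) (at x within ?W)"
      using lim by (rule Lim_null_comparison)
    then show "(Ci \<longlongrightarrow> Ci x) (at x within ?W)" by (rule LIM_zero_cancel)
  qed
  have deriv\<psi>: "(\<psi> has_derivative blinfun_apply (Ci (\<psi> y))) (at y)" if y: "y \<in> ?V" for y
  proof (rule has_derivative_inverse_basic[OF deriv[OF \<psi>W[OF y]] _ _ _ opn y \<phi>\<psi>])
    show "blinfun_apply (Ci (\<psi> y)) \<circ> blinfun_apply (C (\<psi> y)) = id"
      by (simp add: fun_eq_iff Ci(1)[OF \<psi>W[OF y]])
    show "continuous (at y) \<psi>"
      using \<open>continuous_on ?V \<psi>\<close> y continuous_on_eq_continuous_at[OF opn] by blast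
  qed (rule blinfun.bounded_linear_right)
  show ?thesis
  proof
    show "homeomorphism ?W ?V \<phi> \<psi>"
      by (rule homeomorphismI) (auto simp: cont\<phi> \<open>continuous_on ?V \<psi>\<close> \<psi>\<phi>)
    show "C1_map_on ?W \<phi>" by (rule \<phi>C1)
    show "C1_map_on ?V \<psi>"
    proof (rule C1_map_onI[OF opn deriv\<psi>])
      show "continuous_on ?V (\<lambda>y. Ci (\<psi> y))"
        by (rule continuous_on_compose2[OF contCi \<open>continuous_on ?V \<psi>\<close>]) (use \<psi>W in blast)
    qed
    show "fderiv \<psi> (\<phi> x) (C x v) = v" if "x \<in> ?W" for x v
      using fderiv_eq[OF deriv\<psi>[of "\<phi> x"]] that by (simp add: \<psi>\<phi> Ci)
  qed
qed

section \<open>Generalized inverses and the kernels of nearby operators\<close>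

lemma generalized_inverse_apply:
  assumes "generalized_inverse A B"
  shows "B (A (B y)) = B y" "A (B (A x)) = A x"
  using assms unfolding generalized_inverse_def
  by (metis blinfun_apply_blinfun_compose)+

lemma null_space_compose_of_disjoint:
  assumes "range (blinfun_apply T) \<inter> null_space B = {0}"
  shows "B (T v) = 0 \<longleftrightarrow> T v = 0"
proof
  assume "B (T v) = 0"
  then have "T v \<in> range (blinfun_apply T) \<inter> null_space B" by (simp add: null_space_def)
  then show "T v = 0" using assms by blast
qed simp

lemma subspace_null_space: "subspace (null_space A)"
  by (rule subspaceI) (simp_all add: null_space_def blinfun.add_right blinfun.scaleR_right)

lemma closed_null_space: "closed (null_space A)"
  unfolding null_space_def
  by (rule closed_Collect_eq) (auto intro!: continuous_intros linear_continuous_on blinfun.bounded_linear_right)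

lemma range_generalized_inverse:
  assumes "generalized_inverse A B"
  shows "range (blinfun_apply B) = null_space (id_blinfun - (B o\<^sub>L A))"
  using generalized_inverse_apply(1)[OF assms]
  by (auto simp: null_space_def blinfun.diff_left)

text \<open>
  With \<open>P = I - B' A\<close>, the operator \<open>L = P + B' A B T\<close> is the near-identity operator of the hypothesis.
  On the kernel of \<open>T\<close> it agrees with the projection \<open>P\<close>, whose kernel is the range of \<open>B'\<close>; so
  injectivity of \<open>L\<close> makes the intersection trivial. To decompose \<open>w\<close>, solve \<open>L u = P w\<close>: the second
  summand of \<open>L u\<close> vanishes, which puts \<open>u\<close> into the kernel of \<open>T\<close>, and the first gives
  \<open>P (w - u) = 0\<close>. The generalized inverse \<open>B\<close> that controls the range of \<open>T\<close> is kept apart from \<open>B'\<close>, so that a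
  single witness of local fineness yields the decomposition for every \<open>B'\<close>.
\<close>

lemma direct_sum_null_space_range:
  fixes A T :: "'a::banach \<Rightarrow>\<^sub>L 'b::real_normed_vector" and B B' :: "'b \<Rightarrow>\<^sub>L 'a"
  assumes B: "generalized_inverse A B" and B': "generalized_inverse A B'"
    and disj: "range (blinfun_apply T) \<inter> null_space B = {0}"
    and near: "norm ((B' o\<^sub>L A o\<^sub>L B) o\<^sub>L (T - A)) \<le> 1/2"
  shows "direct_sum_decomp (null_space T) (range (blinfun_apply B'))"
proof -
  note gi = generalized_inverse_apply[OF B] generalized_inverse_apply[OF B']
  define L where "L = id_blinfun + ((B' o\<^sub>L A o\<^sub>L B) o\<^sub>L (T - A))"
  have Lv: "L v = v - B' (A v) + B' (A (B (T v)))" for v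
    by (simp add: L_def blinfun.add_left blinfun.diff_left blinfun.diff_right gi)
  have "norm (L - id_blinfun) \<le> 1/2" using near by (simp add: L_def)
  then obtain D where D: "\<And>x. blinfun_apply D (L x) = x" "\<And>y. L (blinfun_apply D y) = y" "norm D \<le> 2"
    by (rule near_identity_inverse) blast
  have "v = 0" if "T v = 0" "v \<in> range (blinfun_apply B')" for v
  proof -
    have "L v = 0" using that by (auto simp: Lv gi)
    then show ?thesis using D(1)[of v] by simp
  qed
  moreover have "0 \<in> range (blinfun_apply B')" by (rule image_eqI[of _ _ 0]) simp_all
  ultimately have int: "null_space T \<inter> range (blinfun_apply B') = {0}"
    by (auto simp: null_space_def)
  have "w \<in> null_space T + range (blinfun_apply B')" for w
  proof -
    define u where "u = D (w - B' (A w))"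
    have Lu: "u - B' (A u) + B' (A (B (T u))) = w - B' (A w)"
      unfolding u_def Lv[symmetric] by (rule D)
    then have "A (u - B' (A u) + B' (A (B (T u)))) = A (w - B' (A w))" by (rule arg_cong)
    then have "A (B (T u)) = 0" by (simp add: blinfun.add_right blinfun.diff_right gi)
    then have "B (T u) = 0" using gi(1)[of "T u"] by simp
    then have u: "u \<in> null_space T"
      using null_space_compose_of_disjoint[OF disj] by (simp add: null_space_def)
    have "w - u = B' (A (w - u))"
      using Lu \<open>B (T u) = 0\<close> by (simp add: blinfun.diff_right algebra_simps)
    then have "w - u \<in> range (blinfun_apply B')" by (metis rangeI)
    from set_plus_intro[OF u this] show ?thesis by simp
  qed
  then show ?thesis
    unfolding direct_sum_decomp_def using int
    by (auto simp: range_generalized_inverse[OF B'] subspace_null_space closed_null_space)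
qed

corollary direct_sum_generalized_inverse:
  fixes A :: "'a::banach \<Rightarrow>\<^sub>L 'b::real_normed_vector"
  assumes "generalized_inverse A B"
  shows "direct_sum_decomp (null_space A) (range (blinfun_apply B))"
proof (rule direct_sum_null_space_range[OF assms assms])
  have "A x = 0" if "B (A x) = 0" for x
    using generalized_inverse_apply(2)[OF assms, of x] that by simp
  then show "range (blinfun_apply A) \<inter> null_space B = {0}"
    by (auto simp: null_space_def intro: image_eqI[of _ _ 0])
qed simp

lemma eventually_compose_diff_le:
  fixes T :: "'c::t2_space \<Rightarrow> ('a::real_normed_vector \<Rightarrow>\<^sub>L 'b::real_normed_vector)"
    and K :: "'b \<Rightarrow>\<^sub>L 'd::real_normed_vector"
  assumes "isCont T x0" "e > 0"
  shows "\<forall>\<^sub>F x in nhds x0. norm (K o\<^sub>L (T x - T x0)) \<le> e"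
proof -
  have "(T \<longlongrightarrow> T x0) (nhds x0)"
    using assms(1) by (simp add: isCont_def tendsto_at_iff_tendsto_nhds)
  then have "((\<lambda>x. norm K * norm (T x - T x0)) \<longlongrightarrow> norm K * 0) (nhds x0)"
    by (intro tendsto_mult_left tendsto_norm_zero LIM_zero)
  then have "\<forall>\<^sub>F x in nhds x0. norm K * norm (T x - T x0) < e"
    using assms(2) by (simp add: order_tendsto_iff)
  then show ?thesis
    by (rule eventually_mono) (meson norm_blinfun_compose less_imp_le order_trans)
qed

lemma C1_map_on_isCont_fderiv:
  assumes "C1_map_on U f" "x \<in> U"
  shows "isCont (fderiv f) x"
  using assms by (auto simp: C1_map_on_def continuous_on_eq_continuous_at)

section \<open>The level set through a generalized regular point\<close>

text \<open>
  The chart \<open>\<phi>\<close> straightens the fibre: \<open>S\<close> becomes the part of the kernel of \<open>A\<close> inside the open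
  set \<open>\<phi> ` W\<close>. One chart covers all of \<open>S\<close>.
\<close>

lemma C1_integrable_at_null_space:
  fixes f :: "'a::banach \<Rightarrow> 'b::real_normed_vector"
  assumes f: "C1_map_on U f" and x0: "x0 \<in> U" and reg: "generalized_regular_point U f x0"
  shows "C1_integrable_at U (\<lambda>x. null_space (fderiv f x)) x0"
proof -
  define T where "T = fderiv f"
  define A where "A = T x0"
  obtain B U0 where B: "generalized_inverse A B" and U0: "open U0" "x0 \<in> U0" "U0 \<subseteq> U"
    and disj: "\<And>x. x \<in> U0 \<Longrightarrow> range (blinfun_apply (T x)) \<inter> null_space B = {0}"
    using reg unfolding generalized_regular_point_def locally_fine_point_def A_def T_def by metis
  note gi = generalized_inverse_apply[OF B]
  have "\<forall>\<^sub>F x in nhds x0. x \<in> U0 \<and> norm (B o\<^sub>L (T x - A)) \<le> 1/2"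
    using eventually_compose_diff_le[OF C1_map_on_isCont_fderiv[OF f x0], of "1/2" B]
      eventually_nhds_in_open[OF U0(1,2)] by (simp add: eventually_conj T_def A_def)
  then obtain r where r: "r > 0" and "\<And>x. x \<in> ball x0 r \<Longrightarrow> x \<in> U0 \<and> norm (B o\<^sub>L (T x - A)) \<le> 1/2"
    unfolding eventually_nhds_metric by (metis mem_ball dist_commute)
  then have WU0: "\<And>x. x \<in> ball x0 r \<Longrightarrow> x \<in> U0"
    and near: "\<And>x. x \<in> ball x0 r \<Longrightarrow> norm (B o\<^sub>L (T x - A)) \<le> 1/2" by blast+
  define W where "W = ball x0 r"
  have x0W: "x0 \<in> W" using r by (simp add: W_def)
  have WU: "x \<in> U" if "x \<in> W" for x using WU0 U0(3) that by (auto simp: W_def)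
  have df: "(f has_derivative blinfun_apply (T x)) (at x)" if "x \<in> W" for x
    unfolding T_def by (rule C1_map_on_has_derivative[OF f WU[OF that]])
  have null: "B (T x v) = 0 \<longleftrightarrow> T x v = 0" if "x \<in> W" for x v
    by (rule null_space_compose_of_disjoint[OF disj]) (use WU0 that in \<open>simp add: W_def\<close>)
  define \<phi> where "\<phi> x = (x - x0) + B (f x - f x0 - A (x - x0))" for x
  define C where "C x = id_blinfun + (B o\<^sub>L (T x - A))" for x
  have Cv: "C x v = v + B (T x v - A v)" for x v
    by (simp add: C_def blinfun.add_left blinfun.diff_left)
  \<comment> \<open>The summands \<open>B A (x - x0)\<close> cancel: \<open>B A B = B\<close> absorbs the projection in the correction term.\<close>
  have BA\<phi>: "B (A (\<phi> x)) = B (f x - f x0)" for x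
    by (simp add: \<phi>_def blinfun.add_right blinfun.diff_right gi)
  have A\<phi>: "A (\<phi> x) = 0 \<longleftrightarrow> B (f x - f x0) = 0" for x
    using BA\<phi>[of x] gi(2)[of "\<phi> x"] by auto
  have d\<phi>: "(\<phi> has_derivative blinfun_apply (C x)) (at x)" if "x \<in> W" for x
  proof -
    have "(\<phi> has_derivative (\<lambda>v. (v - 0) + B (T x v - 0 - A (v - 0)))) (at x)"
      unfolding \<phi>_def
      by (intro has_derivative_add has_derivative_diff has_derivative_ident has_derivative_const
        bounded_linear.has_derivative[OF blinfun.bounded_linear_right] df that)
    moreover have "blinfun_apply (C x) = (\<lambda>v. (v - 0) + B (T x v - 0 - A (v - 0)))"
      by (simp add: fun_eq_iff Cv)
    ultimately show ?thesis by simp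
  qed
  have "continuous_on W T"
    using f WU unfolding C1_map_on_def T_def by (metis continuous_on_subset subsetI)
  then have contC: "continuous_on W C"
    unfolding C_def
    by (intro continuous_intros bounded_linear.continuous_on[OF bounded_bilinear.bounded_linear_right[OF bounded_bilinear_blinfun_compose]])
  obtain \<psi> where hom: "homeomorphism W (\<phi> ` W) \<phi> \<psi>" and C1: "C1_map_on W \<phi>" "C1_map_on (\<phi> ` W) \<psi>"
    and d\<psi>C: "\<And>x v. x \<in> W \<Longrightarrow> fderiv \<psi> (\<phi> x) (C x v) = v"
    using near_identity_diffeomorphism[of x0 r \<phi> C] d\<phi> contC near unfolding W_def
    by (auto simp: C_def)
  define V where "V = \<phi> ` W"
  have V: "open V" using C1(2) by (simp add: C1_map_on_def V_def)
  define S where "S = {x \<in> W. B (f x - f x0) = 0}"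
  have image: "\<phi> ` (S \<inter> W) = null_space A \<inter> V"
    by (auto simp: S_def V_def null_space_def A\<phi>)
  have "C1_submanifold S"
    unfolding C1_submanifold_def
  proof (intro ballI exI conjI)
    fix x assume "x \<in> S"
    then show "x \<in> W" by (simp add: S_def)
    show "splitting (null_space A)"
      unfolding splitting_def using direct_sum_generalized_inverse[OF B] by blast
    show "open W" by (simp add: W_def)
    show "C1_diffeomorphism_on W \<phi>" unfolding C1_diffeomorphism_on_def using hom C1 by blast
    show "openin (top_of_set (null_space A)) (\<phi> ` (S \<inter> W))"
      unfolding image openin_open using V by blast
  qed
  moreover have "v \<in> null_space (T x)" if xS: "x \<in> S" and v: "v \<in> tangent_space S x" for x v
  proof -
    have xW: "x \<in> W" using xS by (simp add: S_def)
    obtain \<delta> c where \<delta>: "\<delta> > 0" and c: "c ` {-\<delta><..<\<delta>} \<subseteq> S" "c 0 = x"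
      "(c has_vector_derivative v) (at 0)"
      using v unfolding tangent_space_def by blast
    have "((\<lambda>t. f (c t)) has_derivative (\<lambda>t. T x (t *\<^sub>R v))) (at 0)"
      using has_derivative_compose[OF c(3)[unfolded has_vector_derivative_def], of f "T x"]
        df[OF xW] c(2) by simp
    from bounded_linear.has_derivative[OF blinfun.bounded_linear_right[of B]
        has_derivative_diff[OF this has_derivative_const[of "f x0"]]]
    have "((\<lambda>t. B (f (c t) - f x0)) has_derivative (\<lambda>t. B (T x (t *\<^sub>R v) - 0))) (at 0)" .
    moreover have "B (f (c t) - f x0) = 0" if "t \<in> {-\<delta><..<\<delta>}" for t
      using subsetD[OF c(1) imageI[OF that]] by (simp add: S_def)
    ultimately have "((\<lambda>t. 0) has_derivative (\<lambda>t. B (T x (t *\<^sub>R v) - 0))) (at 0)"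
      using \<delta> by (elim has_derivative_transform_within_open[where s = "{-\<delta><..<\<delta>}"]) auto
    then have "(\<lambda>t. B (T x (t *\<^sub>R v) - 0)) = (\<lambda>t. 0)"
      by (rule has_derivative_unique) (rule has_derivative_const)
    from fun_cong[OF this, of 1] show "v \<in> null_space (T x)"
      by (simp add: null[OF xW] null_space_def)
  qed
  moreover have "v \<in> tangent_space S x" if xS: "x \<in> S" and v: "v \<in> null_space (T x)" for x v
  proof -
    have xW: "x \<in> W" using xS by (simp add: S_def)
    have Tv: "T x v = 0" using v by (simp add: null_space_def)
    \<comment> \<open>The curve is the preimage of a line: \<open>w\<close> is the direction that \<open>\<phi>\<close> gives to \<open>v\<close>, and it lies in the
      kernel of \<open>A\<close> because \<open>C x v = v - B A v\<close>.\<close>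
    define w where "w = C x v"
    have "A w = 0" by (simp add: w_def Cv Tv blinfun.add_right blinfun.diff_right blinfun.minus_right gi)
    have "\<phi> x \<in> V" using xW by (simp add: V_def)
    then obtain e where e: "e > 0" "ball (\<phi> x) e \<subseteq> V" using V open_contains_ball by blast
    define l where "l t = \<phi> x + t *\<^sub>R w" for t
    \<comment> \<open>Adding \<open>1\<close> keeps the denominator positive when \<open>w = 0\<close>.\<close>
    define \<delta> where "\<delta> = e / (norm w + 1)"
    have "\<delta> > 0" using e(1) by (simp add: \<delta>_def add_nonneg_pos)
    have lV: "l t \<in> V" if "t \<in> {-\<delta><..<\<delta>}" for t
    proof -
      have "\<bar>t\<bar> < \<delta>" using that by auto
      have "norm (t *\<^sub>R w) \<le> \<bar>t\<bar> * (norm w + 1)" by (simp add: mult_left_mono)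
      also have "\<dots> < e"
        using \<open>\<bar>t\<bar> < \<delta>\<close> by (simp add: \<delta>_def pos_less_divide_eq add_nonneg_pos)
      finally have "l t \<in> ball (\<phi> x) e" by (simp add: l_def dist_norm)
      then show ?thesis using e(2) by blast
    qed
    define c where "c t = \<psi> (l t)" for t
    have cS: "c t \<in> S" if "t \<in> {-\<delta><..<\<delta>}" for t
    proof -
      have "\<phi> (c t) = l t" "c t \<in> W"
        using hom lV[OF that] unfolding V_def c_def homeomorphism_def by auto
      moreover have "A (l t) = 0"
        using that \<open>A w = 0\<close> xS A\<phi>[of x]
        by (simp add: l_def S_def blinfun.add_right blinfun.scaleR_right)
      ultimately show ?thesis using A\<phi>[of "c t"] by (simp add: S_def)
    qed
    have dc: "(c has_vector_derivative fderiv \<psi> (l t) w) (at t)" if "t \<in> {-\<delta><..<\<delta>}" for t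
    proof -
      have "(l has_derivative (\<lambda>s. s *\<^sub>R w)) (at t)"
        unfolding l_def by (auto intro!: derivative_eq_intros)
      moreover have "(\<psi> has_derivative blinfun_apply (fderiv \<psi> (l t))) (at (l t))"
        using C1_map_on_has_derivative[OF C1(2)] lV[OF that] by (simp add: V_def)
      ultimately have "(c has_derivative (\<lambda>s. fderiv \<psi> (l t) (s *\<^sub>R w))) (at t)"
        unfolding c_def by (rule has_derivative_compose)
      then show ?thesis by (simp add: has_vector_derivative_def blinfun.scaleR_right)
    qed
    have "continuous_on {-\<delta><..<\<delta>} (\<lambda>t. fderiv \<psi> (l t))"
    proof (rule continuous_on_compose2[of V "fderiv \<psi>"])
      show "continuous_on V (fderiv \<psi>)" using C1(2) by (simp add: C1_map_on_def V_def)
      show "continuous_on {-\<delta><..<\<delta>} l" unfolding l_def by (intro continuous_intros)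
    qed (use lV in blast)
    then have "continuous_on {-\<delta><..<\<delta>} (\<lambda>t. fderiv \<psi> (l t) w)" by (intro continuous_intros)
    then have "c C1_differentiable_on {-\<delta><..<\<delta>}"
      unfolding C1_differentiable_on_def
      by (intro exI[of _ "\<lambda>t. fderiv \<psi> (l t) w"] conjI ballI dc)
    moreover have "c 0 = x" using hom xW by (simp add: c_def l_def homeomorphism_def)
    moreover have "(c has_vector_derivative v) (at 0)"
      using dc[of 0] \<open>\<delta> > 0\<close> d\<psi>C[OF xW, of v] by (simp add: l_def w_def)
    ultimately show "v \<in> tangent_space S x"
      unfolding tangent_space_def using \<open>\<delta> > 0\<close> cS
      by (intro CollectI exI[of _ \<delta>] exI[of _ c] conjI image_subsetI)
  qed
  moreover have "x0 \<in> S" "S \<subseteq> U" using x0W WU by (auto simp: S_def)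
  ultimately show ?thesis
    unfolding C1_integrable_at_def T_def by (intro exI[of _ S]) auto
qed

section \<open>The co-tailed set\<close>

lemma trivial_cotailed_set_null_space:
  fixes f :: "'a::banach \<Rightarrow> 'b::real_normed_vector"
  assumes f: "C1_map_on U f" and x0: "x0 \<in> U" and reg: "generalized_regular_point U f x0"
    and B': "generalized_inverse (fderiv f x0) B'"
  shows "trivial_cotailed_set U (\<lambda>x. null_space (fderiv f x)) x0 (range (blinfun_apply B'))"
proof -
  let ?T = "fderiv f"
  obtain B U0 where B: "generalized_inverse (?T x0) B" and U0: "open U0" "x0 \<in> U0" "U0 \<subseteq> U"
    and disj: "\<And>x. x \<in> U0 \<Longrightarrow> range (blinfun_apply (?T x)) \<inter> null_space B = {0}"
    using reg unfolding generalized_regular_point_def locally_fine_point_def by metis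
  have "\<forall>\<^sub>F x in nhds x0. norm ((B' o\<^sub>L ?T x0 o\<^sub>L B) o\<^sub>L (?T x - ?T x0)) \<le> 1/2"
    by (rule eventually_compose_diff_le[OF C1_map_on_isCont_fderiv[OF f x0]]) simp
  then have "\<forall>\<^sub>F x in nhds x0. x \<in> cotailed_set U (\<lambda>x. null_space (?T x)) (range (blinfun_apply B'))"
    using eventually_nhds_in_open[OF U0(1,2)]
  proof eventually_elim
    case (elim x)
    then show ?case
      unfolding cotailed_set_def
      using U0(3) by (intro CollectI conjI direct_sum_null_space_range[OF B B' disj]) auto
  qed
  then show ?thesis
    unfolding trivial_cotailed_set_def
    using direct_sum_generalized_inverse[OF B'] by (auto simp: eventually_nhds interior_def)
qed

theorem theorem3p2:
  fixes f :: "'a::banach \<Rightarrow> 'b::banach" and U :: "'a set" and x0 :: 'a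
  assumes "open U" and "x0 \<in> U"
    and "C1_map_on U f"
    and "generalized_regular_point U f x0"
  shows "C1_integrable_at U (\<lambda>x. null_space (fderiv f x)) x0 \<and>
    (\<forall>B. generalized_inverse (fderiv f x0) B \<longrightarrow>
       trivial_cotailed_set U (\<lambda>x. null_space (fderiv f x)) x0 (range (blinfun_apply B)))"
  using C1_integrable_at_null_space[OF assms(3,2,4)]
    trivial_cotailed_set_null_space[OF assms(3,2,4)] by blast

end
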